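(* Let $A\cong\mathbb{Z}^n$ with $n\ge1$ (written additively), let $\varphi\colon A\to A$ be a monomorphism, and let $G=\langle A,t\mid tat^{-1}=\varphi(a),\ a\in A\rangle$. If $\varphi$ has an eigenvalue $\lambda\in\mathbb{Z}$ with $|\lambda|>1$, and if $0\ne a\in A$ is a corresponding eigenvector (i.e. $\varphi(a)=\lambda a$), then $\langle\lambda a\rangle$ is not separable from $a$ in $G$.
   Context: For $g_1,g_2\in G$, the subgroup $\langle g_1\rangle$ is said to be separable from $g_2$ if there is a finite-index normal subgroup $\bar G\triangleleft G$ with $g_2\notin\langle g_1\rangle\bar G$. *)

theory Defs
  imports "HOL-Algebra.Product_Groups"
begin

text \<open>
  Groups given by a presentation. A letter \<open>(x, True)\<close> stands for the generator \<open>x\<close> and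
  \<open>(x, False)\<close> for its formal inverse. A relation \<open>u = v\<close> is recorded as the pair \<open>(u, v)\<close>.
\<close>

type_synonym 'x gword = "('x \<times> bool) list"

definition gwords :: "'x set \<Rightarrow> 'x gword set" where
  "gwords S = lists (S \<times> UNIV)"

inductive_set pres_cong :: "'x set \<Rightarrow> ('x gword \<times> 'x gword) set \<Rightarrow> ('x gword \<times> 'x gword) set"
  for S :: "'x set" and R :: "('x gword \<times> 'x gword) set"
where
  refl: "u \<in> gwords S \<Longrightarrow> (u, u) \<in> pres_cong S R"
| sym: "(u, v) \<in> pres_cong S R \<Longrightarrow> (v, u) \<in> pres_cong S R"
| trans: "(u, v) \<in> pres_cong S R \<Longrightarrow> (v, w) \<in> pres_cong S R \<Longrightarrow> (u, w) \<in> pres_cong S R"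
| append: "(u, u') \<in> pres_cong S R \<Longrightarrow> (v, v') \<in> pres_cong S R \<Longrightarrow> (u @ v, u' @ v') \<in> pres_cong S R"
| cancel: "x \<in> S \<Longrightarrow> ([(x, b), (x, \<not> b)], []) \<in> pres_cong S R"
| rel: "(u, v) \<in> R \<Longrightarrow> u \<in> gwords S \<Longrightarrow> v \<in> gwords S \<Longrightarrow> (u, v) \<in> pres_cong S R"

definition pres_class :: "'x set \<Rightarrow> ('x gword \<times> 'x gword) set \<Rightarrow> 'x gword \<Rightarrow> 'x gword set" where
  "pres_class S R w = pres_cong S R `` {w}"

definition presented_group :: "'x set \<Rightarrow> ('x gword \<times> 'x gword) set \<Rightarrow> 'x gword set monoid" where
  "presented_group S R =
    \<lparr>carrier = gwords S // pres_cong S R,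
     monoid.mult = (\<lambda>P Q. \<Union>u\<in>P. \<Union>v\<in>Q. pres_class S R (u @ v)),
     one = pres_class S R []\<rparr>"

lemma pres_cong_gwords:
  "(u, v) \<in> pres_cong S R \<Longrightarrow> u \<in> gwords S \<and> v \<in> gwords S"
  by (induction rule: pres_cong.induct) (auto simp: gwords_def)

lemma equiv_pres_cong: "equiv (gwords S) (pres_cong S R)"
proof (rule equivI)
  show "pres_cong S R \<subseteq> gwords S \<times> gwords S"
    using pres_cong_gwords by fastforce
  show "refl_on (gwords S) (pres_cong S R)"
    by (auto intro: refl_onI pres_cong.refl)
  show "sym (pres_cong S R)"
    by (blast intro: symI pres_cong.sym)
  show "trans (pres_cong S R)"
    by (rule transI) (rule pres_cong.trans)
qed

lemma pres_class_eq_iff: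
  assumes "u \<in> gwords S" "v \<in> gwords S"
  shows "pres_class S R u = pres_class S R v \<longleftrightarrow> (u, v) \<in> pres_cong S R"
  unfolding pres_class_def by (rule eq_equiv_class_iff[OF equiv_pres_cong assms])

lemma carrier_presented_group:
  "carrier (presented_group S R) = pres_class S R ` gwords S"
  by (auto simp: presented_group_def quotient_def pres_class_def)

lemma mult_presented_group:
  assumes "u \<in> gwords S" "v \<in> gwords S"
  shows "pres_class S R u \<otimes>\<^bsub>presented_group S R\<^esub> pres_class S R v = pres_class S R (u @ v)"
proof -
  have "pres_class S R (u' @ v') = pres_class S R (u @ v)"
    if "u' \<in> pres_class S R u" "v' \<in> pres_class S R v" for u' v'
  proof -
    have "(u @ v, u' @ v') \<in> pres_cong S R"
      using that by (auto simp: pres_class_def intro: pres_cong.append)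
    then show ?thesis
      unfolding pres_class_def by (rule equiv_class_eq[OF equiv_pres_cong, symmetric])
  qed
  then have "(\<Union>u'\<in>pres_class S R u. \<Union>v'\<in>pres_class S R v. pres_class S R (u' @ v')) =
      (\<Union>u'\<in>pres_class S R u. \<Union>v'\<in>pres_class S R v. pres_class S R (u @ v))"
    by (intro SUP_cong HOL.refl)
  moreover have "u \<in> pres_class S R u" "v \<in> pres_class S R v"
    using assms by (simp_all add: pres_class_def pres_cong.refl)
  ultimately show ?thesis
    unfolding presented_group_def monoid.simps by blast
qed

lemma one_presented_group: "\<one>\<^bsub>presented_group S R\<^esub> = pres_class S R []"
  by (simp add: presented_group_def)

lemma group_presented_group: "group (presented_group S R)"
proof (rule groupI)
  have nil: "[] \<in> gwords S" and app: "u @ v \<in> gwords S \<longleftrightarrow> u \<in> gwords S \<and> v \<in> gwords S" for u v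
    by (auto simp: gwords_def)
  let ?G = "presented_group S R"
  show "\<one>\<^bsub>?G\<^esub> \<in> carrier ?G"
    using nil by (simp add: carrier_presented_group one_presented_group)
  fix p assume p: "p \<in> carrier ?G"
  then obtain u where u: "u \<in> gwords S" "p = pres_class S R u"
    by (auto simp: carrier_presented_group)
  show "\<one>\<^bsub>?G\<^esub> \<otimes>\<^bsub>?G\<^esub> p = p"
    using u nil by (simp add: one_presented_group mult_presented_group)
  have "\<exists>w\<in>gwords S. (w @ u, []) \<in> pres_cong S R"
    using u(1)
  proof (induction u)
    case Nil
    show ?case using nil by (auto intro: pres_cong.refl)
  next
    case (Cons c u)
    obtain x b where c: "c = (x, b)" by (cases c)
    from Cons c have x: "x \<in> S" and u: "u \<in> gwords S" by (auto simp: gwords_def)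
    obtain w where w: "w \<in> gwords S" "(w @ u, []) \<in> pres_cong S R"
      using Cons.IH u by blast
    let ?w = "w @ [(x, \<not> b)]"
    have "([(x, \<not> b), (x, b)], []) \<in> pres_cong S R"
      using pres_cong.cancel[OF x, of "\<not> b"] by simp
    then have "(w @ [(x, \<not> b), (x, b)] @ u, w @ [] @ u) \<in> pres_cong S R"
      using w u by (intro pres_cong.append pres_cong.refl)
    then have "(?w @ c # u, []) \<in> pres_cong S R"
      using pres_cong.trans[OF _ w(2)] c by simp
    moreover have "?w \<in> gwords S" using w x by (auto simp: gwords_def)
    ultimately show ?case by blast
  qed
  then obtain w where w: "w \<in> gwords S" "(w @ u, []) \<in> pres_cong S R" by blast
  then have "pres_class S R w \<otimes>\<^bsub>?G\<^esub> p = \<one>\<^bsub>?G\<^esub>"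
    using u nil by (simp add: one_presented_group mult_presented_group pres_class_eq_iff app)
  then show "\<exists>q\<in>carrier ?G. q \<otimes>\<^bsub>?G\<^esub> p = \<one>\<^bsub>?G\<^esub>"
    using w(1) by (auto simp: carrier_presented_group)
  fix q assume "q \<in> carrier ?G"
  then obtain v where v: "v \<in> gwords S" "q = pres_class S R v"
    by (auto simp: carrier_presented_group)
  show "p \<otimes>\<^bsub>?G\<^esub> q \<in> carrier ?G"
    using u v by (auto simp: mult_presented_group carrier_presented_group app)
  fix r assume "r \<in> carrier ?G"
  then obtain z where z: "z \<in> gwords S" "r = pres_class S R z"
    by (auto simp: carrier_presented_group)
  show "p \<otimes>\<^bsub>?G\<^esub> q \<otimes>\<^bsub>?G\<^esub> r = p \<otimes>\<^bsub>?G\<^esub> (q \<otimes>\<^bsub>?G\<^esub> r)"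
    using u v z by (simp add: mult_presented_group app)
qed

text \<open>
  The group \<open>\<langle>A, t | t a t\<inverse> = \<phi>(a), a \<in> A\<rangle>\<close>. As usual, writing the group \<open>A\<close> to the left of
  the bar means that its elements are generators and that all relations holding in \<open>A\<close>,
  i.e. its multiplication table, are imposed. The group \<open>A\<close> is written multiplicatively.
\<close>

datatype 'a hnn_gen = Base 'a | Stable

definition hnn_gens :: "('a, 'b) monoid_scheme \<Rightarrow> 'a hnn_gen set" where
  "hnn_gens A = insert Stable (Base ` carrier A)"

definition hnn_rels ::
    "('a, 'b) monoid_scheme \<Rightarrow> ('a \<Rightarrow> 'a) \<Rightarrow> ('a hnn_gen gword \<times> 'a hnn_gen gword) set" where
  "hnn_rels A \<phi> =
    {([(Base x, True), (Base y, True)], [(Base (x \<otimes>\<^bsub>A\<^esub> y), True)]) | x y.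
        x \<in> carrier A \<and> y \<in> carrier A} \<union>
    {([(Stable, True), (Base x, True), (Stable, False)], [(Base (\<phi> x), True)]) | x.
        x \<in> carrier A}"

definition ascending_hnn ::
    "('a, 'b) monoid_scheme \<Rightarrow> ('a \<Rightarrow> 'a) \<Rightarrow> 'a hnn_gen gword set monoid" where
  "ascending_hnn A \<phi> = presented_group (hnn_gens A) (hnn_rels A \<phi>)"

text \<open>The element of \<open>ascending_hnn A \<phi>\<close> represented by an element of \<open>A\<close>.\<close>

definition hnn_base ::
    "('a, 'b) monoid_scheme \<Rightarrow> ('a \<Rightarrow> 'a) \<Rightarrow> 'a \<Rightarrow> 'a hnn_gen gword set" where
  "hnn_base A \<phi> x = pres_class (hnn_gens A) (hnn_rels A \<phi>) [(Base x, True)]"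

definition cyclic_separable_from :: "('a, 'b) monoid_scheme \<Rightarrow> 'a \<Rightarrow> 'a \<Rightarrow> bool" where
  "cyclic_separable_from G g\<^sub>1 g\<^sub>2 \<longleftrightarrow>
    (\<exists>N. N \<lhd> G \<and> finite (rcosets\<^bsub>G\<^esub> N) \<and> g\<^sub>2 \<notin> generate G {g\<^sub>1} <#>\<^bsub>G\<^esub> N)"

end

theory Submission
  imports Defs "HOL-Algebra.Multiplicative_Group"
begin

text \<open>
  In a finite quotient of \<open>G\<close> of order \<open>k\<close>, let \<open>x\<close> and \<open>s\<close> be the images of \<open>a\<close> and \<open>t\<close>.
  Conjugation by \<open>s\<close> raises \<open>x\<close> to the power \<open>\<lambda>\<close>, so conjugation by \<open>s\<^sup>k = 1\<close> raises it to the
  power \<open>\<lambda>\<^sup>k\<close>. Hence \<open>x\<close> is the \<open>\<lambda>\<^sup>k\<^sup>-\<^sup>1\<close>-th power of \<open>x\<^sup>\<lambda>\<close>, and no finite quotient separates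
  the subgroup generated by \<open>a\<^sup>\<lambda>\<close> from \<open>a\<close>.
\<close>

context group
begin

text \<open>Conjugation by \<open>g\<close> is an endomorphism of the group, and homomorphisms
  commute with integer powers.\<close>

lemma conj_int_pow:
  fixes i :: int
  assumes "g \<in> carrier G" "x \<in> carrier G"
  shows "g \<otimes> x [^] i \<otimes> inv g = (g \<otimes> x \<otimes> inv g) [^] i"
proof -
  interpret conj: group_hom G G "\<lambda>y. g \<otimes> y \<otimes> inv g"
    using assms(1) by unfold_locales (auto intro!: homI simp: m_assoc inv_solve_left)
  show ?thesis
    by (rule conj.hom_int_pow[OF assms(2)])
qed

lemma conj_nat_pow_eq_int_pow:
  fixes l :: int and k :: nat
  assumes "t \<in> carrier G" "x \<in> carrier G" "t \<otimes> x \<otimes> inv t = x [^] l"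
  shows "t [^] k \<otimes> x \<otimes> inv (t [^] k) = x [^] (l ^ k)"
proof (induction k)
  case 0
  show ?case using assms by (simp add: int_pow_1)
next
  case (Suc k)
  \<comment> \<open>Peel off the innermost conjugation: it turns \<open>x\<close> into
    \<open>x [^] l\<close>. The outer conjugation by \<open>t [^] k\<close> commutes with this
    power, so the induction hypothesis applies inside it.\<close>
  have "t [^] Suc k \<otimes> x \<otimes> inv (t [^] Suc k) = t [^] k \<otimes> (t \<otimes> x \<otimes> inv t) \<otimes> inv (t [^] k)"
    using assms(1,2) by (simp add: inv_mult_group m_assoc)
  also have "\<dots> = (x [^] (l ^ k)) [^] l"
    using Suc assms by (simp add: conj_int_pow)
  also have "\<dots> = x [^] (l ^ Suc k)"
    using assms(2) by (simp add: int_pow_pow mult.commute)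
  finally show ?case .
qed

lemma eq_int_pow_of_conj_eq_int_pow:
  fixes l :: int
  assumes "finite (carrier G)" "t \<in> carrier G" "x \<in> carrier G" "t \<otimes> x \<otimes> inv t = x [^] l"
  obtains m :: int where "x = (x [^] l) [^] m"
proof
  \<comment> \<open>Finiteness makes the order positive, so \<open>order G - 1\<close> is not
    truncated and one factor \<open>l\<close> can be split off \<open>l ^ order G\<close>.\<close>
  have "order G \<noteq> 0"
    using assms(1) order_gt_0_iff_finite by simp
  then have "l * l ^ (order G - 1) = l ^ order G"
    by (simp add: power_eq_if)
  then have "(x [^] l) [^] (l ^ (order G - 1)) = x [^] (l ^ order G)"
    using assms(3) by (simp add: int_pow_pow)
  also have "\<dots> = x"
    using conj_nat_pow_eq_int_pow[OF assms(2-4), of "order G"] assms(2,3)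
    by (simp add: pow_order_eq_1)
  finally show "x = (x [^] l) [^] (l ^ (order G - 1))" by simp
qed

text \<open>The conjugation relation passes to every finite quotient \<open>G Mod N\<close>, where
  the image of \<open>x\<close> is a power of the image of \<open>x [^] l\<close>. Pulled back to
  \<open>G\<close>, this puts \<open>x\<close> into the product of the cyclic subgroup with
  \<open>N\<close>.\<close>

lemma not_cyclic_separable_from_of_conj:
  fixes l :: int
  assumes "t \<in> carrier G" "x \<in> carrier G" "t \<otimes> x \<otimes> inv t = x [^] l"
  shows "\<not> cyclic_separable_from G (x [^] l) x"
  unfolding cyclic_separable_from_def
proof (intro notI, elim exE conjE)
  fix N assume N: "N \<lhd> G" and fin: "finite (rcosets N)"
    and x_notin: "x \<notin> generate G {x [^] l} <#> N"
  interpret N: normal N G by (fact N)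
  interpret Q: group "G Mod N" by (rule N.factorgroup_is_group)
  interpret \<pi>: group_hom G "G Mod N" "\<lambda>g. N #> g"
    by unfold_locales (rule N.r_coset_hom_Mod)
  have pow: "N #> y [^] i = (N #> y) [^]\<^bsub>G Mod N\<^esub> i" if "y \<in> carrier G" for y and i :: int
    using that by (rule \<pi>.hom_int_pow)
  have "(N #> t) \<otimes>\<^bsub>G Mod N\<^esub> (N #> x) \<otimes>\<^bsub>G Mod N\<^esub> inv\<^bsub>G Mod N\<^esub> (N #> t) = (N #> x) [^]\<^bsub>G Mod N\<^esub> l"
    using assms(1,2) unfolding pow[OF assms(2), symmetric] assms(3)[symmetric]
    by (simp only: \<pi>.hom_mult \<pi>.hom_inv m_closed inv_closed)
  moreover have "finite (carrier (G Mod N))"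
    using fin by (simp add: FactGroup_def)
  ultimately obtain m :: int
    where "N #> x = ((N #> x) [^]\<^bsub>G Mod N\<^esub> l) [^]\<^bsub>G Mod N\<^esub> m"
    using Q.eq_int_pow_of_conj_eq_int_pow assms(1,2) \<pi>.hom_closed by metis
  then have "N #> x = N #> (x [^] l) [^] m"
    using assms(2) by (simp add: pow)
  also have "\<dots> = (x [^] l) [^] m <# N"
    \<comment> \<open>The set product with \<open>N\<close> on the right is a union of left cosets,
      while \<open>G Mod N\<close> consists of right cosets; normality identifies the two.\<close>
    using N.coset_eq assms(2) by simp
  finally have "x \<in> (x [^] l) [^] m <# N"
    using rcos_self[OF assms(2) N.is_subgroup] by simp
  moreover have "(x [^] l) [^] m \<in> generate G {x [^] l}"
    using assms(2) by (auto simp: generate_pow)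
  ultimately show False
    using x_notin by (auto simp: l_coset_def set_mult_def)
qed

end

lemma pres_class_rel:
  assumes "(u, v) \<in> R" "u \<in> gwords S" "v \<in> gwords S"
  shows "pres_class S R u = pres_class S R v"
  using assms by (simp add: pres_class_eq_iff pres_cong.rel)

text \<open>Free cancellation makes the letter with flipped sign a left inverse, which in a group is
  the inverse.\<close>

lemma inv_pres_class_letter:
  assumes "x \<in> S"
  shows "inv\<^bsub>presented_group S R\<^esub> (pres_class S R [(x, b)]) = pres_class S R [(x, \<not> b)]"
proof -
  interpret group "presented_group S R" by (rule group_presented_group)
  have w: "[(x, c)] \<in> gwords S" "[(x, c), (x, d)] \<in> gwords S" "[] \<in> gwords S" for c d
    using assms by (auto simp: gwords_def)
  have "pres_class S R [(x, \<not> b)] \<otimes>\<^bsub>presented_group S R\<^esub> pres_class S R [(x, b)]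
      = \<one>\<^bsub>presented_group S R\<^esub>"
    using pres_cong.cancel[OF assms, of "\<not> b" R] w
    by (simp add: mult_presented_group one_presented_group pres_class_eq_iff)
  then show ?thesis
    using w by (intro inv_equality) (auto simp: carrier_presented_group)
qed

text \<open>The multiplication table of \<open>A\<close> is among the relations. This lets integer
  powers computed in \<open>A\<close> be carried into the presented group.\<close>

lemma hnn_base_hom:
  assumes "monoid A"
  shows "hnn_base A \<phi> \<in> hom A (ascending_hnn A \<phi>)"
proof (rule homI)
  interpret monoid A by fact
  let ?S = "hnn_gens A" and ?R = "hnn_rels A \<phi>"
  fix x assume x: "x \<in> carrier A"
  then show "hnn_base A \<phi> x \<in> carrier (ascending_hnn A \<phi>)"
    by (simp add: hnn_base_def ascending_hnn_def carrier_presented_group gwords_def hnn_gens_def)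
  fix y assume y: "y \<in> carrier A"
  have "pres_class ?S ?R [(Base x, True), (Base y, True)] = pres_class ?S ?R [(Base (x \<otimes>\<^bsub>A\<^esub> y), True)]"
    using x y by (intro pres_class_rel) (auto simp: hnn_rels_def gwords_def hnn_gens_def)
  then show "hnn_base A \<phi> (x \<otimes>\<^bsub>A\<^esub> y) =
      hnn_base A \<phi> x \<otimes>\<^bsub>ascending_hnn A \<phi>\<^esub> hnn_base A \<phi> y"
    using x y
    by (simp add: hnn_base_def ascending_hnn_def mult_presented_group gwords_def hnn_gens_def)
qed

text \<open>The letter \<open>(Stable, False)\<close> in the second family of relations represents
  the inverse of \<open>t\<close>, so these relations become genuine conjugation equations.\<close>

lemma conj_hnn_base:
  assumes "x \<in> carrier A" "\<phi> x \<in> carrier A"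
  defines "t \<equiv> pres_class (hnn_gens A) (hnn_rels A \<phi>) [(Stable, True)]"
  shows "t \<in> carrier (ascending_hnn A \<phi>)"
    and "t \<otimes>\<^bsub>ascending_hnn A \<phi>\<^esub> hnn_base A \<phi> x \<otimes>\<^bsub>ascending_hnn A \<phi>\<^esub> inv\<^bsub>ascending_hnn A \<phi>\<^esub> t
      = hnn_base A \<phi> (\<phi> x)"
proof -
  let ?S = "hnn_gens A" and ?R = "hnn_rels A \<phi>"
  have Stable: "Stable \<in> ?S" by (simp add: hnn_gens_def)
  show "t \<in> carrier (ascending_hnn A \<phi>)"
    using Stable by (simp add: t_def ascending_hnn_def carrier_presented_group gwords_def)
  have "pres_class ?S ?R [(Stable, True), (Base x, True), (Stable, False)]
      = pres_class ?S ?R [(Base (\<phi> x), True)]"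
    using assms(1,2) by (intro pres_class_rel) (auto simp: hnn_rels_def gwords_def hnn_gens_def)
  then show "t \<otimes>\<^bsub>ascending_hnn A \<phi>\<^esub> hnn_base A \<phi> x \<otimes>\<^bsub>ascending_hnn A \<phi>\<^esub> inv\<^bsub>ascending_hnn A \<phi>\<^esub> t
      = hnn_base A \<phi> (\<phi> x)"
    using assms(1) inv_pres_class_letter[OF Stable, of ?R True]
    by (simp add: t_def hnn_base_def ascending_hnn_def mult_presented_group gwords_def hnn_gens_def)
qed

theorem lemma5p10:
  fixes A :: "('a, 'b) monoid_scheme" and n :: nat and \<phi> :: "'a \<Rightarrow> 'a"
    and l :: int and a :: 'a
  assumes "comm_group A"
    and "n \<ge> 1"
    and "A \<cong> product_group {..<n} (\<lambda>_. integer_group)"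
    and "\<phi> \<in> mon A A"
    and "\<bar>l\<bar> > 1"
    and "a \<in> carrier A"
    and "a \<noteq> \<one>\<^bsub>A\<^esub>"
    and "\<phi> a = a [^]\<^bsub>A\<^esub> l"
  shows "\<not> cyclic_separable_from (ascending_hnn A \<phi>)
           (hnn_base A \<phi> (a [^]\<^bsub>A\<^esub> l)) (hnn_base A \<phi> a)"
proof -
  interpret A: comm_group A by fact
  let ?G = "ascending_hnn A \<phi>"
  interpret G: group ?G
    unfolding ascending_hnn_def by (rule group_presented_group)
  interpret group_hom A ?G "hnn_base A \<phi>"
    by unfold_locales (rule hnn_base_hom[OF A.is_monoid])
  \<comment> \<open>By the eigenvector equation, \<open>\<phi> a\<close> is an integer power of
    \<open>a\<close>.\<close>
  have "\<phi> a \<in> carrier A" using assms(6,8) by simp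
  note conj = conj_hnn_base[where \<phi> = \<phi>, OF assms(6) this]
  have pow: "hnn_base A \<phi> (a [^]\<^bsub>A\<^esub> l) = hnn_base A \<phi> a [^]\<^bsub>?G\<^esub> l"
    by (rule hom_int_pow[OF assms(6)])
  show ?thesis
    \<comment> \<open>With the eigenvector equation and \<open>pow\<close>, the stable letter
      conjugates the image of \<open>a\<close> to its \<open>l\<close>-th power, as the general
      criterion requires.\<close>
    using G.not_cyclic_separable_from_of_conj[OF conj(1) hom_closed[OF assms(6)]] conj(2)
    unfolding assms(8) pow by blast
qed

end
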